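(* Let $\epsilon\in(0,1/2)$ and $\delta>0$, let $g_\epsilon$, $\overline{g}$, $\underline{g}$, $\mathcal{C}_\delta$ be as defined in the context, and let $\hat{\mathcal{Z}}_0^N$ be the polyhedral inner approximation defined in the context from $N\ge 2$ points $(\ell_1,u_1),\dots,(\ell_N,u_N)$ on $\mathcal{C}_\delta$ with decreasing $\ell_i$'s. Let $\operatorname{bd}(\hat{\mathcal{Z}}_0^N)$ be the boundary of $\hat{\mathcal{Z}}_0^N$. Then $$\delta\ \le\ \max_{(\ell,u)\in\operatorname{bd}(\hat{\mathcal{Z}}_0^N)} g_\epsilon(\ell,u)\ \le\ \max\big\{(1+O(\Delta^N))\cdot\delta,\ \overline{g}(u_N),\ \underline{g}(\ell_1)\big\},$$ where $$\Delta^N:=\max_{i\in\{1,\dots,N-1\}}\|(\ell_i,u_i)-(\ell_{i+1},u_{i+1})\|_1 .$$ Furthermore, $$\lim_{\substack{\Delta^N\to0\\ \ell_N\searrow-\infty\\ u_1\nearrow+\infty}}\ \max_{(\ell,u)\in\operatorname{bd}(\hat{\mathcal{Z}}_0^N)} g_\epsilon(\ell,u)=\delta .$$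
   Context: $\Phi$ is the cumulative distribution function of the one-dimensional standard Gaussian, and $(a)^+=\max\{a,0\}$. For $(\ell,u)\in\mathbb{R}^2$, $$g_\epsilon(\ell,u):=\int_0^{+\infty}\big(\Phi(u-t)-\Phi(\ell+t)-(1-\epsilon)\big)^+dt,\qquad \mathcal{C}_\delta:=\{(\ell,u)\in\mathbb{R}^2: g_\epsilon(\ell,u)=\delta\}.$$ One has $\mathcal{C}_\delta\subseteq\mathbb{R}_-\times\mathbb{R}_+$. For $(\ell,u)\in\mathbb{R}_-\times\mathbb{R}_+$, $$\overline{g}(u):=\int_0^{+\infty}\big(\Phi(u-t)-(1-\epsilon)\big)^+dt,\qquad \underline{g}(\ell):=\int_0^{+\infty}\big(\epsilon-\Phi(\ell+t)\big)^+dt .$$ Given points $(\ell_1,u_1),\dots,(\ell_N,u_N)\in\mathcal{C}_\delta$ with decreasing $\ell_i$'s, $\hat{\mathcal{Z}}_0^N$ is the set of all $(\ell,u)\in\mathbb{R}^2$ satisfying $$\ell\le\ell_1,\qquad u\ge u_N,\qquad (u-u_i)(\ell_i-\ell_{i+1})\ge(u_i-u_{i+1})(\ell-\ell_i)\quad\text{for all } i\in\{1,\dots,N-1\}.$$ It is an inner approximation of $\mathcal{Z}_0=\{(\ell,u): g_\epsilon(\ell,u)\ge\delta\}$. The maximum of $g_\epsilon$ over the unbounded set $\operatorname{bd}(\hat{\mathcal{Z}}_0^N)$ is to be read as a supremum. *)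

theory Defs
  imports "HOL-Probability.Probability"
begin

definition Phi :: "real \<Rightarrow> real" where
  "Phi = cdf std_normal_distribution"

definition g :: "real \<Rightarrow> real \<Rightarrow> real \<Rightarrow> real" where
  "g \<epsilon> l u = (LBINT t:{0..}. max (Phi (u - t) - Phi (l + t) - (1 - \<epsilon>)) 0)"

definition g_upper :: "real \<Rightarrow> real \<Rightarrow> real" where
  "g_upper \<epsilon> u = (LBINT t:{0..}. max (Phi (u - t) - (1 - \<epsilon>)) 0)"

definition g_lower :: "real \<Rightarrow> real \<Rightarrow> real" where
  "g_lower \<epsilon> l = (LBINT t:{0..}. max (\<epsilon> - Phi (l + t)) 0)"

definition level_curve :: "real \<Rightarrow> real \<Rightarrow> (real \<times> real) set" where
  "level_curve \<epsilon> \<delta> = {(l, u). g \<epsilon> l u = \<delta>}"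

text \<open>A family of points is given by its size \<open>N\<close> and its two coordinate sequences; only the
  values at the indices \<open>1, \<dots>, N\<close> matter.\<close>

definition points_on_curve ::
  "real \<Rightarrow> real \<Rightarrow> nat \<Rightarrow> (nat \<Rightarrow> real) \<Rightarrow> (nat \<Rightarrow> real) \<Rightarrow> bool" where
  "points_on_curve \<epsilon> \<delta> N l u \<longleftrightarrow>
     N \<ge> 2 \<and> (\<forall>i\<in>{1..N}. (l i, u i) \<in> level_curve \<epsilon> \<delta>) \<and> (\<forall>i\<in>{1..N-1}. l (i + 1) < l i)"

definition inner_approx :: "nat \<Rightarrow> (nat \<Rightarrow> real) \<Rightarrow> (nat \<Rightarrow> real) \<Rightarrow> (real \<times> real) set" where
  "inner_approx N l u = {(x, y). x \<le> l 1 \<and> y \<ge> u N \<and>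
     (\<forall>i\<in>{1..N-1}. (y - u i) * (l i - l (i + 1)) \<ge> (u i - u (i + 1)) * (x - l i))}"

definition mesh :: "nat \<Rightarrow> (nat \<Rightarrow> real) \<Rightarrow> (nat \<Rightarrow> real) \<Rightarrow> real" where
  "mesh N l u = Max ((\<lambda>i. \<bar>l i - l (i + 1)\<bar> + \<bar>u i - u (i + 1)\<bar>) ` {1..N-1})"

text \<open>The boundary is unbounded. The supremum is taken in the extended reals, so that a finite
  upper bound on it is a genuine claim (the supremum of an unbounded set of reals is unspecified).\<close>

definition boundary_sup :: "real \<Rightarrow> nat \<Rightarrow> (nat \<Rightarrow> real) \<Rightarrow> (nat \<Rightarrow> real) \<Rightarrow> ereal" where
  "boundary_sup \<epsilon> N l u = (SUP (x, y)\<in>frontier (inner_approx N l u). ereal (g \<epsilon> x y))"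

text \<open>Joint limit over all families of points on the curve, with \<open>N\<close> free to vary: the mesh tends
  to \<open>0\<close>, the last first coordinate to \<open>-\<infinity>\<close> and the first second coordinate to \<open>+\<infinity>\<close>.\<close>

definition refinement ::
  "real \<Rightarrow> real \<Rightarrow> (nat \<times> (nat \<Rightarrow> real) \<times> (nat \<Rightarrow> real)) filter" where
  "refinement \<epsilon> \<delta> =
     inf (filtercomap (\<lambda>(N, l, u). mesh N l u) (nhds 0))
    (inf (filtercomap (\<lambda>(N, l, u). l N) at_bot)
    (inf (filtercomap (\<lambda>(N, l, u). u 1) at_top)
         (principal {(N, l, u). points_on_curve \<epsilon> \<delta> N l u})))"

end

theory Submission
  imports Defs
begin

text \<open>
  For \<open>\<epsilon> < 1 / 2\<close> the integrand \<open>Phi (u - t) - Phi (l + t) - (1 - \<epsilon>)\<close>, called the gap below, decreases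
  in \<open>t\<close> and is positive only where \<open>u - t > 0\<close> and \<open>l + t < 0\<close>. There \<open>Phi (u - t)\<close> and
  \<open>- Phi (l + t)\<close> are concave, so the gap is jointly concave in \<open>(l, u, t)\<close>. If \<open>T\<close> is the zero of the
  gap, \<open>g\<close> is the signed area of the gap over \<open>[0, T]\<close>, and the signed area over any other \<open>[0, S]\<close> is
  at most \<open>g\<close>. Two facts follow.

  First, the superlevel sets of \<open>g\<close> have supporting lines with positive slope at all points where
  \<open>g > 0\<close> (\<open>superlevel_support\<close>): the gap at \<open>(l', u')\<close> is compared with the tangent of the gap at
  \<open>(l, u)\<close> after scaling \<open>t\<close> so that the zeros of the two gaps match. Hence the points on the level
  curve increase in both coordinates and have increasing slopes, and every point lies on or above the
  line through any two neighbours (\<open>points_above_lines\<close>). The boundary of the approximation therefore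
  lies in the union of the segments between neighbours, a vertical ray above \<open>(l 1, u 1)\<close>, and a horizontal ray
  to the left of \<open>(l N, u N)\<close>.

  Second, \<open>g\<close> is Lipschitz with constant 1 for the 1-norm (\<open>g_lipschitz\<close>), so \<open>g \<le> \<delta> + mesh N l u\<close> on
  each segment; this gives the constant \<open>C = 1 / \<delta>\<close>. On the two rays \<open>g\<close> is bounded by \<open>g_lower\<close> and
  \<open>g_upper\<close>. The lower bound \<open>\<delta>\<close> is attained at \<open>(l 1, u 1)\<close>.

  For the limit, \<open>g > \<delta>\<close> when \<open>- l\<close> and \<open>u\<close> are both at least some \<open>M\<close> (\<open>g_large\<close>). So \<open>u N \<le> M\<close> once
  \<open>l N \<le> - M\<close>, and then \<open>g_upper\<close> exceeds \<open>g (l N, u N) = \<delta>\<close> by at most \<open>M * Phi (l N + M)\<close>, which tends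
  to 0; \<open>g_lower\<close> at \<open>l 1\<close> is treated in the same way.
\<close>

section \<open>The standard normal distribution function\<close>

interpretation std_normal: real_distribution std_normal_distribution
  by (rule real_dist_normal_dist)

lemma Phi_nonneg: "0 \<le> Phi x" and Phi_le_1: "Phi x \<le> 1"
  unfolding Phi_def by (auto intro: std_normal.cdf_nonneg std_normal.cdf_bounded_prob)

lemma Phi_mono: "x \<le> y \<Longrightarrow> Phi x \<le> Phi y"
  unfolding Phi_def by (rule std_normal.cdf_nondecreasing)

lemma Phi_at_top: "(Phi \<longlongrightarrow> 1) at_top" and Phi_at_bot: "(Phi \<longlongrightarrow> 0) at_bot"
  unfolding Phi_def by (rule std_normal.cdf_lim_at_top_prob std_normal.cdf_lim_at_bot)+

text \<open>The derivative of \<open>Phi\<close> comes from the fundamental theorem of calculus, applied to the integral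
  of the density over a bounded interval.\<close>

lemma Phi_diff_eq_integral:
  assumes "a < b"
  shows "Phi b - Phi a = (LBINT x=a..b. std_normal_density x)"
proof -
  have "Phi b - Phi a = (LINT x|std_normal_distribution. indicator {a<..b} x)"
    unfolding Phi_def std_normal.cdf_diff_eq[OF assms] by simp
  also have "\<dots> = (LBINT x:{a<..b}. std_normal_density x)"
    by (subst integral_density) (auto simp: set_lebesgue_integral_def mult.commute)
  finally show ?thesis
    using assms by (simp add: interval_integral_Ioc)
qed

lemma DERIV_Phi: "(Phi has_real_derivative std_normal_density x) (at x)"
proof -
  have cont: "continuous_on {x - 1..x + 1} std_normal_density"
    unfolding normal_density_def by (auto intro!: continuous_intros)
  have "((\<lambda>v. LBINT y=x - 1..v. std_normal_density y) has_vector_derivative std_normal_density x)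
          (at x within {x - 1..x + 1})"
    by (rule interval_integral_FTC2[OF _ _ cont]) auto
  then have "((\<lambda>v. LBINT y=x - 1..v. std_normal_density y) has_real_derivative std_normal_density x)
          (at x)"
    by (simp add: has_real_derivative_iff_has_vector_derivative at_within_Icc_at)
  then have "((\<lambda>v. Phi (x - 1) + (LBINT y=x - 1..v. std_normal_density y))
          has_real_derivative std_normal_density x) (at x)"
    by (auto intro!: derivative_eq_intros)
  then show ?thesis
    by (rule has_field_derivative_transform_within_open[of _ _ _ "{x - 1<..}"])
       (auto simp: Phi_diff_eq_integral[symmetric])
qed

lemmas DERIV_Phi' [derivative_intros] = DERIV_Phi[THEN DERIV_chain2]

lemma continuous_on_Phi [continuous_intros]: "continuous_on S f \<Longrightarrow> continuous_on S (\<lambda>x. Phi (f x))"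
  by (rule continuous_on_compose2[of UNIV Phi])
     (auto intro!: continuous_at_imp_continuous_on DERIV_isCont[OF DERIV_Phi])

lemma borel_measurable_Phi [measurable]: "Phi \<in> borel_measurable borel"
  by (intro borel_measurable_continuous_onI continuous_intros)

lemma Phi_strict_mono: "x < y \<Longrightarrow> Phi x < Phi y"
  by (rule DERIV_pos_imp_increasing[where f = Phi])
     (auto intro!: DERIV_Phi normal_density_pos exI)

text \<open>The sum \<open>Phi x + Phi (- x)\<close> is constant because the density is even, and its limit at
  infinity is 1.\<close>

lemma Phi_uminus: "Phi (- x) = 1 - Phi x"
proof -
  have "((\<lambda>x. Phi x + Phi (- x)) has_real_derivative 0) (at y)" for y
    by (auto intro!: derivative_eq_intros simp: normal_density_def)
  then have const: "Phi x + Phi (- x) = Phi y + Phi (- y)" for y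
    by (intro DERIV_isconst_all[where f = "\<lambda>x. Phi x + Phi (- x)"]) auto
  have "((\<lambda>y. Phi y + Phi (- y)) \<longlongrightarrow> 1 + 0) at_top"
    by (intro tendsto_add Phi_at_top
          filterlim_compose[OF Phi_at_bot filterlim_uminus_at_bot_at_top])
  moreover have "(\<lambda>y. Phi y + Phi (- y)) = (\<lambda>y. Phi x + Phi (- x))"
    by (rule ext) (rule const[symmetric])
  ultimately have "((\<lambda>y. Phi x + Phi (- x)) \<longlongrightarrow> 1) (at_top :: real filter)"
    by simp
  then show ?thesis
    by (simp add: tendsto_const_iff)
qed

lemma Phi_gt_half_imp_pos: "1 / 2 < Phi x \<Longrightarrow> 0 < x"
  using Phi_uminus[of 0] Phi_mono[of x 0] by force

lemma Phi_lt_half_imp_neg: "Phi x < 1 / 2 \<Longrightarrow> x < 0"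
  using Phi_gt_half_imp_pos[of "- x"] Phi_uminus[of x] by simp

text \<open>The density decreases on the positive half-line, so \<open>Phi\<close> is concave there and lies below its
  tangents.\<close>

lemma Phi_le_tangent:
  assumes "0 \<le> x" "0 \<le> y"
  shows "Phi y \<le> Phi x + std_normal_density x * (y - x)"
proof -
  have dens: "std_normal_density b \<le> std_normal_density a" if "0 \<le> a" "a \<le> b" for a b
    using that by (simp add: std_normal_density_def divide_right_mono power_mono)
  consider "x = y" | "x < y" | "y < x"
    by linarith
  then show ?thesis
  proof cases
    case 2
    then obtain z where "x < z" "Phi y - Phi x = (y - x) * std_normal_density z"
      using MVT2[of x y Phi std_normal_density] DERIV_Phi by blast
    then show ?thesis
      using mult_left_mono[OF dens[of x z], of "y - x"] assms 2 by (simp add: algebra_simps)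
  next
    case 3
    then obtain z where "y < z" "z < x" "Phi x - Phi y = (x - y) * std_normal_density z"
      using MVT2[of y x Phi std_normal_density] DERIV_Phi by blast
    then show ?thesis
      using mult_left_mono[OF dens[of z x], of "x - y"] assms 3 by (simp add: algebra_simps)
  qed simp
qed

lemma Phi_ge_tangent:
  assumes "x \<le> 0" "y \<le> 0"
  shows "Phi x + std_normal_density x * (y - x) \<le> Phi y"
proof -
  have "std_normal_density (- x) = std_normal_density x"
    by (simp add: std_normal_density_def)
  then show ?thesis
    using Phi_le_tangent[of "- x" "- y"] assms by (simp add: Phi_uminus algebra_simps)
qed

section \<open>The function \<open>g\<close> as a largest signed area\<close>

definition gap :: "real \<Rightarrow> real \<Rightarrow> real \<Rightarrow> real \<Rightarrow> real" where
  "gap \<epsilon> l u t = Phi (u - t) - Phi (l + t) - (1 - \<epsilon>)"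

text \<open>An antiderivative of \<open>Phi\<close>.\<close>

definition Psi :: "real \<Rightarrow> real" where
  "Psi x = x * Phi x + std_normal_density x"

text \<open>The antiderivative of the gap that vanishes at 0.\<close>

definition gap_area :: "real \<Rightarrow> real \<Rightarrow> real \<Rightarrow> real \<Rightarrow> real" where
  "gap_area \<epsilon> l u t = Psi u - Psi (u - t) - (Psi (l + t) - Psi l) - (1 - \<epsilon>) * t"

lemma DERIV_Psi: "(Psi has_real_derivative Phi x) (at x)"
proof -
  have "(std_normal_density has_real_derivative - x * std_normal_density x) (at x)"
    unfolding std_normal_density_def[abs_def] by (rule derivative_eq_intros refl | simp)+
  then show ?thesis
    unfolding Psi_def by (auto intro!: derivative_eq_intros DERIV_Phi)
qed

lemmas DERIV_Psi' [derivative_intros] = DERIV_Psi[THEN DERIV_chain2]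

lemma DERIV_gap_area: "(gap_area \<epsilon> l u has_real_derivative gap \<epsilon> l u t) (at t)"
  unfolding gap_area_def gap_def by (auto intro!: derivative_eq_intros)

lemmas DERIV_gap_area' [derivative_intros] = DERIV_gap_area[THEN DERIV_chain2]

lemma gap_area_0 [simp]: "gap_area \<epsilon> l u 0 = 0"
  by (simp add: gap_area_def)

lemma gap_antimono: "s \<le> t \<Longrightarrow> gap \<epsilon> l u t \<le> gap \<epsilon> l u s"
  unfolding gap_def using Phi_mono[of "u - t" "u - s"] Phi_mono[of "l + s" "l + t"] by simp

lemma DERIV_gap:
  "(gap \<epsilon> l u has_real_derivative - (std_normal_density (u - t) + std_normal_density (l + t))) (at t)"
  unfolding gap_def by (auto intro!: derivative_eq_intros)

lemmas DERIV_gap' [derivative_intros] = DERIV_gap[THEN DERIV_chain2]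

lemma continuous_on_gap: "continuous_on S (gap \<epsilon> l u)"
  unfolding gap_def by (intro continuous_intros)

lemma borel_measurable_gap [measurable]: "gap \<epsilon> l u \<in> borel_measurable borel"
  by (intro borel_measurable_continuous_onI continuous_on_gap)

lemma g_eq: "g \<epsilon> l u = (LBINT t:{0..}. max (gap \<epsilon> l u t) 0)"
  by (simp add: g_def gap_def)

lemma set_integrable_bounded_support:
  fixes f :: "real \<Rightarrow> real"
  assumes [measurable]: "f \<in> borel_measurable borel"
    and "\<And>t. 0 \<le> t \<Longrightarrow> \<bar>f t\<bar> \<le> 1" "\<And>t. K < t \<Longrightarrow> f t = 0"
  shows "set_integrable lborel {0..} f"
  unfolding set_integrable_def
proof (rule Bochner_Integration.integrable_bound)
  show "integrable lborel (indicator {0..K} :: real \<Rightarrow> real)"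
    by (simp add: integrable_indicator_iff emeasure_lborel_Icc_eq)
  show "AE t in lborel. norm (indicator {0..} t *\<^sub>R f t) \<le> norm (indicator {0..K} t :: real)"
    using assms(2,3) by (intro AE_I2) (auto simp: indicator_def not_le)
qed measurable

lemma set_integrable_Icc_gap:
  "set_integrable lborel {0..S} (gap \<epsilon> l u)"
  by (intro borel_integrable_atLeastAtMost' continuous_on_gap)

lemma set_integral_Icc_gap:
  assumes "0 \<le> S"
  shows "(LBINT t:{0..S}. gap \<epsilon> l u t) = gap_area \<epsilon> l u S"
proof -
  have "(\<integral>t. gap \<epsilon> l u t * indicator {0..S} t \<partial>lborel) = gap_area \<epsilon> l u S - gap_area \<epsilon> l u 0"
    using assms continuous_on_gap[of UNIV]
    by (intro integral_FTC_Icc_real DERIV_gap_area) (auto simp: continuous_on_eq_continuous_at)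
  then show ?thesis
    by (simp add: set_lebesgue_integral_def mult.commute)
qed

context
  fixes \<epsilon> :: real
  assumes eps: "0 < \<epsilon>" "\<epsilon> < 1 / 2"
begin

text \<open>Where the gap is nonnegative, its arguments lie in the half-lines on which the summands of the
  gap are concave.\<close>

lemma gap_pos_imp:
  assumes "0 \<le> gap \<epsilon> l u t"
  shows "0 < u - t" "l + t < 0"
proof -
  have "1 - \<epsilon> \<le> Phi (u - t)" "Phi (l + t) \<le> \<epsilon>"
    using assms Phi_le_1[of "u - t"] Phi_nonneg[of "l + t"] by (auto simp: gap_def)
  then show "0 < u - t" "l + t < 0"
    using eps by (intro Phi_gt_half_imp_pos Phi_lt_half_imp_neg; linarith)+
qed

lemma set_integrable_gap: "set_integrable lborel {0..} (\<lambda>t. max (gap \<epsilon> l u t) 0)"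
proof (rule set_integrable_bounded_support[where K = u])
  show "\<bar>max (gap \<epsilon> l u t) 0\<bar> \<le> 1" for t
    using Phi_le_1[of "u - t"] Phi_nonneg[of "l + t"] eps by (auto simp: gap_def)
  show "max (gap \<epsilon> l u t) 0 = 0" if "u < t" for t
    using gap_pos_imp(1)[of l u t] that by force
qed measurable

lemma set_integrable_g_upper: "set_integrable lborel {0..} (\<lambda>t. max (Phi (u - t) - (1 - \<epsilon>)) 0)"
proof (rule set_integrable_bounded_support[where K = u])
  show "\<bar>max (Phi (u - t) - (1 - \<epsilon>)) 0\<bar> \<le> 1" for t
    using Phi_le_1[of "u - t"] eps by auto
  show "max (Phi (u - t) - (1 - \<epsilon>)) 0 = 0" if "u < t" for t
    using Phi_gt_half_imp_pos[of "u - t"] that eps by force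
qed measurable

lemma set_integrable_g_lower: "set_integrable lborel {0..} (\<lambda>t. max (\<epsilon> - Phi (l + t)) 0)"
proof (rule set_integrable_bounded_support[where K = "- l"])
  show "\<bar>max (\<epsilon> - Phi (l + t)) 0\<bar> \<le> 1" for t
    using Phi_nonneg[of "l + t"] eps by auto
  show "max (\<epsilon> - Phi (l + t)) 0 = 0" if "- l < t" for t
    using Phi_lt_half_imp_neg[of "l + t"] that eps by force
qed measurable

lemma g_nonneg: "0 \<le> g \<epsilon> l u"
  unfolding g_eq set_lebesgue_integral_def by (intro integral_nonneg_AE AE_I2) auto

lemma g_le_g_upper: "g \<epsilon> l u \<le> g_upper \<epsilon> u"
  unfolding g_eq g_upper_def
proof (intro set_integral_mono set_integrable_gap set_integrable_g_upper)
  show "max (gap \<epsilon> l u t) 0 \<le> max (Phi (u - t) - (1 - \<epsilon>)) 0" for t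
    using Phi_nonneg[of "l + t"] by (auto simp: gap_def max_def)
qed

lemma g_le_g_lower: "g \<epsilon> l u \<le> g_lower \<epsilon> l"
  unfolding g_eq g_lower_def
proof (intro set_integral_mono set_integrable_gap set_integrable_g_lower)
  show "max (gap \<epsilon> l u t) 0 \<le> max (\<epsilon> - Phi (l + t)) 0" for t
    using Phi_le_1[of "u - t"] by (auto simp: gap_def max_def)
qed

text \<open>The gap is at most its positive part. This bounds \<open>g\<close> from below without reference to the
  zero of the gap.\<close>

lemma gap_area_le_g:
  assumes "0 \<le> S"
  shows "gap_area \<epsilon> l u S \<le> g \<epsilon> l u"
proof -
  have "gap_area \<epsilon> l u S = (LBINT t:{0..S}. gap \<epsilon> l u t)"
    using assms by (simp add: set_integral_Icc_gap)
  also have "\<dots> \<le> g \<epsilon> l u"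
    using set_integrable_Icc_gap set_integrable_gap
    unfolding g_eq set_lebesgue_integral_def set_integrable_def
    by (intro integral_mono) (auto simp: indicator_def)
  finally show ?thesis .
qed

text \<open>The gap decreases, so the integral of its positive part stops at its zero.\<close>

lemma g_eq_gap_area:
  assumes "0 < g \<epsilon> l u"
  obtains T where "0 < T" "gap \<epsilon> l u T = 0" "g \<epsilon> l u = gap_area \<epsilon> l u T"
proof -
  have pos: "0 < gap \<epsilon> l u 0"
  proof (rule ccontr)
    assume "\<not> 0 < gap \<epsilon> l u 0"
    then have "(\<lambda>t. indicator {0..} t * max (gap \<epsilon> l u t) 0) = (\<lambda>t :: real. 0)"
      using gap_antimono[of 0 _ \<epsilon> l u] by (intro ext) (fastforce simp: indicator_def)
    then have "g \<epsilon> l u = 0"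
      unfolding g_eq set_lebesgue_integral_def real_scaleR_def by simp
    then show False
      using assms by simp
  qed
  have "\<exists>T\<ge>0. T \<le> \<bar>u\<bar> \<and> gap \<epsilon> l u T = 0"
    using gap_pos_imp(1)[of l u "\<bar>u\<bar>"] pos
    by (intro IVT2' continuous_on_gap) force+
  then obtain T where T: "0 \<le> T" "gap \<epsilon> l u T = 0"
    by blast
  have "max (gap \<epsilon> l u t) 0 * indicator {0..} t = gap \<epsilon> l u t * indicator {0..T} t" for t
    using gap_antimono[of t T \<epsilon> l u] gap_antimono[of T t \<epsilon> l u] T
    by (cases "t \<le> T") (auto simp: indicator_def)
  then have "g \<epsilon> l u = (LBINT t:{0..T}. gap \<epsilon> l u t)"
    unfolding g_eq set_lebesgue_integral_def by (simp add: mult.commute)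
  moreover have "T \<noteq> 0"
    using pos T by auto
  ultimately show ?thesis
    using that[of T] T by (simp add: set_integral_Icc_gap)
qed

text \<open>By \<open>gap_area_le_g\<close> it suffices to compare the two gaps over the same interval \<open>[0, T]\<close>, where
  \<open>T\<close> is optimal for \<open>(l', u')\<close>.\<close>

lemma g_lipschitz: "g \<epsilon> l' u' \<le> g \<epsilon> l u + \<bar>l' - l\<bar> + \<bar>u' - u\<bar>"
proof (cases "0 < g \<epsilon> l' u'")
  case False
  then show ?thesis
    using g_nonneg[of l u] by linarith
next
  case True
  then obtain T where T: "0 < T" "g \<epsilon> l' u' = gap_area \<epsilon> l' u' T"
    by (rule g_eq_gap_area)
  \<comment> \<open>An increment of \<open>Psi\<close> over a fixed length has slope in \<open>[0, 1]\<close>, being an increment of \<open>Phi\<close>.\<close>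
  have lip: "\<bar>(Psi (b + T) - Psi b) - (Psi (a + T) - Psi a)\<bar> \<le> \<bar>b - a\<bar>" for a b
  proof -
    have "norm ((Psi (b + T) - Psi b) - (Psi (a + T) - Psi a)) \<le> 1 * norm (b - a)"
    proof (rule field_differentiable_bound[of UNIV])
      show "((\<lambda>x. Psi (x + T) - Psi x) has_field_derivative Phi (x + T) - Phi x) (at x within UNIV)"
        for x
        by (auto intro!: derivative_eq_intros)
      show "norm (Phi (x + T) - Phi x) \<le> 1" for x
        using Phi_nonneg[of x] Phi_le_1[of "x + T"] Phi_mono[of x "x + T"] T by simp
    qed auto
    then show ?thesis
      by simp
  qed
  have "gap_area \<epsilon> l' u' T \<le> gap_area \<epsilon> l u T + \<bar>l' - l\<bar> + \<bar>u' - u\<bar>"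
    using lip[of l' l] lip[of "u' - T" "u - T"] by (simp add: gap_area_def abs_le_iff)
  then show ?thesis
    using gap_area_le_g[of T l u] T by linarith
qed

section \<open>Supporting lines of the superlevel sets\<close>

text \<open>The proof takes for \<open>p\<close> and \<open>q\<close> the partial derivatives \<open>- \<partial>g/\<partial>l\<close> and \<open>\<partial>g/\<partial>u\<close>, so the superlevel
  set of \<open>g\<close> lies on one side of its tangent line. Let \<open>T\<close> and \<open>T' = c T\<close> be the zeros of the gaps at \<open>(l, u)\<close> and \<open>(l', u')\<close>. Concavity bounds
  the gap at \<open>(l', u', c s)\<close> by the linearisation at \<open>(l, u, s)\<close>. Integration over \<open>s\<close> from 0 to \<open>T\<close>,
  by parts in the term with \<open>c - 1\<close>, gives
  \<open>g (l', u') \<le> c (2 - c) g (l, u) + c (q (u' - u) - p (l' - l))\<close>.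
  As \<open>c (2 - c) \<le> 1\<close>, the last term is nonnegative when \<open>g (l', u') \<ge> g (l, u)\<close>.\<close>

lemma superlevel_support:
  assumes pos: "0 < g \<epsilon> l u"
  shows "\<exists>p>0. \<exists>q>0. \<forall>l' u'. g \<epsilon> l u \<le> g \<epsilon> l' u' \<longrightarrow> p * (l' - l) \<le> q * (u' - u)"
proof -
  obtain T where T: "0 < T" "gap \<epsilon> l u T = 0" "g \<epsilon> l u = gap_area \<epsilon> l u T"
    using pos by (rule g_eq_gap_area)
  define p where "p = Phi (l + T) - Phi l"
  define q where "q = Phi u - Phi (u - T)"
  have "p * (l' - l) \<le> q * (u' - u)" if le: "g \<epsilon> l u \<le> g \<epsilon> l' u'" for l' u'
  proof -
    have "0 < g \<epsilon> l' u'"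
      using pos le by linarith
    then obtain T' where T': "0 < T'" "gap \<epsilon> l' u' T' = 0" "g \<epsilon> l' u' = gap_area \<epsilon> l' u' T'"
      by (rule g_eq_gap_area)
    define c where "c = T' / T"
    have c: "0 < c" "c * T = T'"
      using T T' by (auto simp: c_def)
    \<comment> \<open>\<open>D s\<close> is \<open>c\<close> times the difference between the linearisation at \<open>(l, u, s)\<close> and the gap at
      \<open>(l', u', c s)\<close>, and \<open>F\<close> is its antiderivative.\<close>
    define F where "F s = c * (gap_area \<epsilon> l u s + (Phi u - Phi (u - s)) * (u' - u)
        - (Phi (l + s) - Phi l) * (l' - l) + (c - 1) * (s * gap \<epsilon> l u s - gap_area \<epsilon> l u s))
        - gap_area \<epsilon> l' u' (c * s)" for s
    define D where "D s = c * (gap \<epsilon> l u s + std_normal_density (u - s) * (u' - u)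
        - std_normal_density (l + s) * (l' - l)
        - (c - 1) * s * (std_normal_density (u - s) + std_normal_density (l + s)))
        - c * gap \<epsilon> l' u' (c * s)" for s
    have der: "(F has_real_derivative D s) (at s)" for s
      unfolding F_def[abs_def] D_def
      by (rule derivative_eq_intros refl)+ (simp add: algebra_simps)
    have "0 \<le> D s" if s: "0 \<le> s" "s \<le> T" for s
    proof -
      have cs: "c * s \<le> T'"
        using s c mult_left_mono[of s T c] by simp
      have "0 < u - s" "l + s < 0" "0 < u' - c * s" "l' + c * s < 0"
        using gap_pos_imp[of l u T] gap_pos_imp[of l' u' T'] T T' s cs by auto
      then have "gap \<epsilon> l' u' (c * s) \<le> gap \<epsilon> l u s
          + std_normal_density (u - s) * ((u' - c * s) - (u - s))
          - std_normal_density (l + s) * ((l' + c * s) - (l + s))"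
        using Phi_le_tangent[of "u - s" "u' - c * s"] Phi_ge_tangent[of "l + s" "l' + c * s"]
        by (simp add: gap_def)
      from mult_left_mono[OF this, of c] c show ?thesis
        by (simp add: D_def algebra_simps)
    qed
    then have "F 0 \<le> F T"
      using der T by (intro DERIV_nonneg_imp_nondecreasing[of 0 T F]) (blast intro: less_imp_le)+
    then have "g \<epsilon> l' u' \<le> c * (g \<epsilon> l u + q * (u' - u) - p * (l' - l) - (c - 1) * g \<epsilon> l u)"
      using T T' c by (simp add: F_def p_def q_def)
    also have "\<dots> = g \<epsilon> l u - (c - 1)\<^sup>2 * g \<epsilon> l u + c * (q * (u' - u) - p * (l' - l))"
      by (simp add: algebra_simps power2_eq_square)
    also have "\<dots> \<le> g \<epsilon> l u + c * (q * (u' - u) - p * (l' - l))"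
      using pos by simp
    finally have "0 \<le> c * (q * (u' - u) - p * (l' - l))"
      using le by linarith
    then show ?thesis
      using c by (simp add: zero_le_mult_iff)
  qed
  moreover have "0 < p" "0 < q"
    using T Phi_strict_mono by (auto simp: p_def q_def)
  ultimately show ?thesis
    by blast
qed

lemma curve_increasing:
  assumes "0 < g \<epsilon> l u" "g \<epsilon> l u = g \<epsilon> l' u'" "l < l'"
  shows "u < u'"
proof -
  obtain p q where pq: "0 < p" "0 < q"
    "\<And>l' u'. g \<epsilon> l u \<le> g \<epsilon> l' u' \<Longrightarrow> p * (l' - l) \<le> q * (u' - u)"
    using superlevel_support[OF assms(1)] by blast
  have "0 < p * (l' - l)"
    using pq assms by simp
  also have "\<dots> \<le> q * (u' - u)"
    using pq assms by simp
  finally show ?thesis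
    using pq by (simp add: zero_less_mult_iff)
qed

text \<open>The slope of the supporting line at the middle point separates the two chord slopes.\<close>

lemma curve_slopes_mono:
  assumes "0 < g \<epsilon> b v" "g \<epsilon> a u = g \<epsilon> b v" "g \<epsilon> c w = g \<epsilon> b v" "a < b" "b < c"
  shows "(v - u) * (c - b) \<le> (w - v) * (b - a)"
proof -
  obtain p q where pq: "0 < p" "0 < q"
    "\<And>l' u'. g \<epsilon> b v \<le> g \<epsilon> l' u' \<Longrightarrow> p * (l' - b) \<le> q * (u' - v)"
    using superlevel_support[OF assms(1)] by blast
  have "q * (v - u) * (c - b) \<le> p * (b - a) * (c - b)"
    using pq(3)[of a u] assms by (intro mult_right_mono) (auto simp: algebra_simps)
  also have "\<dots> = p * (c - b) * (b - a)"
    by simp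
  also have "\<dots> \<le> q * (w - v) * (b - a)"
    using pq(3)[of c w] assms by (intro mult_right_mono) auto
  finally show ?thesis
    using pq by (simp add: mult.assoc)
qed

section \<open>The boundary of the polyhedral approximation\<close>

text \<open>The approximation is cut out by finitely many weak affine inequalities; the points where all of
  them are strict form an open subset.\<close>

lemma frontier_inner_approxD:
  assumes "(x, y) \<in> frontier (inner_approx N l u)"
  shows "(x, y) \<in> inner_approx N l u"
    and "x = l 1 \<or> y = u N \<or>
      (\<exists>i\<in>{1..N - 1}. (y - u i) * (l i - l (i + 1)) = (u i - u (i + 1)) * (x - l i))"
proof -
  define strict where "strict = {z. fst z < l 1} \<inter> {z. u N < snd z} \<inter>
    (\<Inter>i\<in>{1..N - 1}. {z. (u i - u (i + 1)) * (fst z - l i) < (snd z - u i) * (l i - l (i + 1))})"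
  have eq: "inner_approx N l u = {z. fst z \<le> l 1} \<inter> {z. u N \<le> snd z} \<inter>
    (\<Inter>i\<in>{1..N - 1}. {z. (u i - u (i + 1)) * (fst z - l i) \<le> (snd z - u i) * (l i - l (i + 1))})"
    by (auto simp: inner_approx_def)
  have "closed (inner_approx N l u)"
    unfolding eq by (intro closed_Int closed_INT ballI closed_Collect_le continuous_intros)
  then show mem: "(x, y) \<in> inner_approx N l u"
    using assms frontier_subset_closed by blast
  have "open strict"
    unfolding strict_def
    by (intro open_Int open_INT finite_atLeastAtMost ballI open_Collect_less continuous_intros)
  moreover have "strict \<subseteq> inner_approx N l u"
    unfolding eq strict_def by (auto intro: less_imp_le)
  ultimately have "strict \<subseteq> interior (inner_approx N l u)"
    by (simp add: interior_maximal)
  then have "(x, y) \<notin> strict"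
    using assms by (auto simp: frontier_def)
  then show "x = l 1 \<or> y = u N \<or>
      (\<exists>i\<in>{1..N - 1}. (y - u i) * (l i - l (i + 1)) = (u i - u (i + 1)) * (x - l i))"
    using mem unfolding eq strict_def by (simp add: less_le) metis
qed

lemma mesh_ge:
  assumes "i \<in> {1..N - 1}"
  shows "\<bar>l i - l (i + 1)\<bar> + \<bar>u i - u (i + 1)\<bar> \<le> mesh N l u"
  unfolding mesh_def using assms by (intro Max_ge) auto

context
  fixes \<delta> :: real and N :: nat and l u :: "nat \<Rightarrow> real"
  assumes delta: "0 < \<delta>" and points: "points_on_curve \<epsilon> \<delta> N l u"
begin

lemma N_ge_2: "2 \<le> N"
  using points by (simp add: points_on_curve_def)

lemma g_point: "1 \<le> i \<Longrightarrow> i \<le> N \<Longrightarrow> g \<epsilon> (l i) (u i) = \<delta>"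
  using points by (simp add: points_on_curve_def level_curve_def)

lemma l_decreasing:
  assumes "1 \<le> i" "i < j" "j \<le> N"
  shows "l j < l i"
  using assms(2,3)
proof (induction j)
  case (Suc j)
  have "l (Suc j) < l j"
    using points assms(1) Suc.prems by (simp add: points_on_curve_def)
  moreover have "l j \<le> l i"
    using Suc by (cases "i = j") auto
  ultimately show ?case
    by simp
qed simp

lemma u_decreasing: "1 \<le> i \<Longrightarrow> i < j \<Longrightarrow> j \<le> N \<Longrightarrow> u j < u i"
  using curve_increasing[of "l j" "u j" "l i" "u i"] l_decreasing[of i j] g_point[of i] g_point[of j] delta
  by simp

lemma mesh_nonneg: "0 \<le> mesh N l u"
proof -
  have "0 \<le> \<bar>l 1 - l (1 + 1)\<bar> + \<bar>u 1 - u (1 + 1)\<bar>"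
    by simp
  also have "\<dots> \<le> mesh N l u"
    using N_ge_2 by (intro mesh_ge) auto
  finally show ?thesis .
qed

text \<open>The points on the curve are in convex position: the inequality is \<open>curve_slopes_mono\<close> for the
  triple formed by \<open>j\<close> and the two ends \<open>i\<close>, \<open>i + 1\<close> of the segment.\<close>

lemma points_above_lines:
  assumes "1 \<le> j" "j \<le> N" "i \<in> {1..N - 1}"
  shows "(u i - u (i + 1)) * (l j - l i) \<le> (u j - u i) * (l i - l (i + 1))"
proof -
  note bounds = assms N_ge_2
  consider "j < i" | "j = i" | "j = i + 1" | "i + 1 < j"
    by linarith
  then show ?thesis
  proof cases
    case 1
    then show ?thesis
      using bounds delta g_point[of i] g_point[of j] g_point[of "i + 1"]
        l_decreasing[of j i] l_decreasing[of i "i + 1"]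
      by (intro curve_slopes_mono) auto
  next
    case 4
    then have "(u (i + 1) - u j) * (l i - l (i + 1)) \<le> (u i - u (i + 1)) * (l (i + 1) - l j)"
      using bounds delta g_point[of i] g_point[of j] g_point[of "i + 1"]
        l_decreasing[of "i + 1" j] l_decreasing[of i "i + 1"]
      by (intro curve_slopes_mono) auto
    then show ?thesis
      by (simp add: algebra_simps)
  qed (auto simp: algebra_simps)
qed

text \<open>Points to the right of \<open>(l 1, u 1)\<close> violate \<open>x \<le> l 1\<close>.\<close>

lemma first_point_in_frontier: "(l 1, u 1) \<in> frontier (inner_approx N l u)"
proof -
  have "(l 1, u 1) \<in> inner_approx N l u"
    using u_decreasing[of 1 N] N_ge_2 points_above_lines[of 1] by (auto simp: inner_approx_def)
  moreover have "(l 1, u 1) \<notin> interior (inner_approx N l u)"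
  proof
    assume "(l 1, u 1) \<in> interior (inner_approx N l u)"
    then obtain e where e: "0 < e" "ball (l 1, u 1) e \<subseteq> inner_approx N l u"
      by (auto simp: mem_interior)
    have "(l 1 + e / 2, u 1) \<in> ball (l 1, u 1) e"
      using e by (simp add: dist_Pair_Pair dist_real_def)
    then show False
      using e by (auto simp: inner_approx_def)
  qed
  ultimately show ?thesis
    using closure_subset by (auto simp: frontier_def)
qed

text \<open>The only boundary points that are not on one of the two rays lie on the segments between
  neighbouring points, where \<open>g_lipschitz\<close> applies.\<close>

lemma g_frontier_le:
  assumes "(x, y) \<in> frontier (inner_approx N l u)"
  shows "g \<epsilon> x y \<le> Max {\<delta> + mesh N l u, g_upper \<epsilon> (u N), g_lower \<epsilon> (l 1)}"
proof -
  note mem = frontier_inner_approxD(1)[OF assms]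
  have xy: "x \<le> l 1" "u N \<le> y"
    and above: "\<And>i. i \<in> {1..N - 1} \<Longrightarrow>
      (u i - u (i + 1)) * (x - l i) \<le> (y - u i) * (l i - l (i + 1))"
    using mem by (auto simp: inner_approx_def)
  consider "x = l 1" | "y = u N" | i where "x < l 1" "u N < y" "i \<in> {1..N - 1}"
      "(y - u i) * (l i - l (i + 1)) = (u i - u (i + 1)) * (x - l i)"
    using frontier_inner_approxD(2)[OF assms] xy by fastforce
  then have "g \<epsilon> x y \<le> \<delta> + mesh N l u \<or> g \<epsilon> x y \<le> g_upper \<epsilon> (u N) \<or> g \<epsilon> x y \<le> g_lower \<epsilon> (l 1)"
  proof cases
    case 1
    then show ?thesis
      using g_le_g_lower by simp
  next
    case 2
    then show ?thesis
      using g_le_g_upper by simp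
  next
    case 3
    have step: "0 < l i - l (i + 1)" "0 < u i - u (i + 1)"
      using 3 l_decreasing[of i "i + 1"] u_decreasing[of i "i + 1"] by auto
    have below: "y \<le> z" if "(u i - u (i + 1)) * (x - l i) \<le> (z - u i) * (l i - l (i + 1))" for z
      using mult_right_le_imp_le[OF _ step(1), of "y - u i" "z - u i"] that 3(4) by simp
    \<comment> \<open>Left of \<open>l N\<close>, the line through the points \<open>i\<close> and \<open>i + 1\<close> runs below the height \<open>u N\<close>.\<close>
    have "l N < x"
    proof (rule ccontr)
      assume "\<not> l N < x"
      then have "(u i - u (i + 1)) * (x - l i) \<le> (u i - u (i + 1)) * (l N - l i)"
        using step by (intro mult_left_mono) auto
      then have "y \<le> u N"
        using points_above_lines[of N i] 3 N_ge_2 by (intro below) auto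
      then show False
        using 3 by simp
    qed
    \<comment> \<open>Locate the segment \<open>l (j + 1) \<le> x < l j\<close> above \<open>x\<close>; its point at \<open>x\<close> has height \<open>z\<close>.\<close>
    define k where "k = (LEAST k. 1 \<le> k \<and> l k \<le> x)"
    have k: "1 \<le> k" "l k \<le> x" "k \<le> N"
      using LeastI[of "\<lambda>k. 1 \<le> k \<and> l k \<le> x" N] Least_le[of "\<lambda>k. 1 \<le> k \<and> l k \<le> x" N]
        \<open>l N < x\<close> N_ge_2 by (auto simp: k_def)
    define j where "j = k - 1"
    have "k \<noteq> 1"
      using k 3 by auto
    then have j: "1 \<le> j" "k = j + 1" "j \<in> {1..N - 1}"
      using k by (auto simp: j_def)
    then have "x < l j"
      using not_less_Least[of j "\<lambda>k. 1 \<le> k \<and> l k \<le> x", folded k_def] by (simp add: not_le)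
    define s where "s = (l j - x) / (l j - l (j + 1))"
    have L: "0 < l j - l (j + 1)"
      using j l_decreasing[of j "j + 1"] by auto
    have s: "0 \<le> s" "s \<le> 1" "x = l j - s * (l j - l (j + 1))"
      using L \<open>x < l j\<close> k j by (auto simp: s_def)
    define z where "z = u j - s * (u j - u (j + 1))"
    \<comment> \<open>Both ends of segment \<open>j\<close> lie above line \<open>i\<close>, hence so does \<open>(x, z)\<close>, whereas \<open>(x, y)\<close> is on
      line \<open>i\<close> and above line \<open>j\<close>.\<close>
    have "y \<le> z"
    proof (rule below)
      have "(u i - u (i + 1)) * (x - l i) = (1 - s) * ((u i - u (i + 1)) * (l j - l i))
          + s * ((u i - u (i + 1)) * (l (j + 1) - l i))"
        by (simp add: s(3) algebra_simps)
      also have "\<dots> \<le> (1 - s) * ((u j - u i) * (l i - l (i + 1)))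
          + s * ((u (j + 1) - u i) * (l i - l (i + 1)))"
        using s j 3 N_ge_2 k by (intro add_mono mult_left_mono points_above_lines) auto
      also have "\<dots> = (z - u i) * (l i - l (i + 1))"
        by (simp add: z_def algebra_simps)
      finally show "(u i - u (i + 1)) * (x - l i) \<le> (z - u i) * (l i - l (i + 1))" .
    qed
    moreover have "z \<le> y"
    proof -
      have "(z - u j) * (l j - l (j + 1)) = (u j - u (j + 1)) * (x - l j)"
        by (simp add: z_def s(3))
      also have "\<dots> \<le> (y - u j) * (l j - l (j + 1))"
        using above[OF j(3)] .
      finally show ?thesis
        using L by simp
    qed
    ultimately have y: "y = u j - s * (u j - u (j + 1))"
      by (simp add: z_def)
    have offset: "x - l j = - (s * (l j - l (j + 1)))" "y - u j = - (s * (u j - u (j + 1)))"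
      using s(3) y by auto
    have "g \<epsilon> x y \<le> g \<epsilon> (l j) (u j) + \<bar>x - l j\<bar> + \<bar>y - u j\<bar>"
      by (rule g_lipschitz)
    also have "\<dots> = \<delta> + s * (\<bar>l j - l (j + 1)\<bar> + \<bar>u j - u (j + 1)\<bar>)"
      using g_point[of j] j(1,2) k(3) s(1)
      by (simp only: offset abs_minus_cancel abs_mult distrib_left abs_of_nonneg add.assoc)
    also have "\<dots> \<le> \<delta> + 1 * (\<bar>l j - l (j + 1)\<bar> + \<bar>u j - u (j + 1)\<bar>)"
      using s by (intro add_left_mono mult_right_mono) auto
    also have "\<dots> \<le> \<delta> + mesh N l u"
      using mesh_ge[OF j(3), of l u] by simp
    finally show ?thesis ..
  qed
  then show ?thesis
    by auto
qed

lemma boundary_sup_ge: "ereal \<delta> \<le> boundary_sup \<epsilon> N l u"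
  unfolding boundary_sup_def
  by (rule SUP_upper2[OF first_point_in_frontier]) (use g_point[of 1] N_ge_2 in simp)

lemma boundary_sup_le:
  "boundary_sup \<epsilon> N l u \<le> ereal (Max {\<delta> + mesh N l u, g_upper \<epsilon> (u N), g_lower \<epsilon> (l 1)})"
  unfolding boundary_sup_def
  by (rule SUP_least) (clarify, simp only: ereal_less_eq g_frontier_le)

end

section \<open>Comparison with the one-sided functions far out on the level curve\<close>

text \<open>The terms \<open>Phi (l + t)\<close> and \<open>1 - Phi (u - t)\<close> that \<open>g_upper\<close> and \<open>g_lower\<close> neglect matter only for
  \<open>t\<close> in a bounded interval \<open>[0, M]\<close>, where they are at most their value \<open>c\<close> at \<open>M\<close>.\<close>

lemma integral_le_g_plus:
  assumes f: "set_integrable lborel {0..} f" and M: "0 \<le> M"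
    and near: "\<And>t. 0 \<le> t \<Longrightarrow> t \<le> M \<Longrightarrow> f t \<le> max (gap \<epsilon> l u t) 0 + c"
    and far: "\<And>t. M < t \<Longrightarrow> f t \<le> 0"
  shows "(LBINT t:{0..}. f t) \<le> g \<epsilon> l u + M * c"
proof -
  have const: "set_integrable lborel {0..} (\<lambda>t. indicator {0..M} t * c)"
    by (simp add: set_integrable_def integrable_indicator_iff emeasure_lborel_Icc_eq
          flip: mult.assoc indicator_inter_arith)
  have "(LBINT t:{0..}. f t) \<le> (LBINT t:{0..}. max (gap \<epsilon> l u t) 0 + indicator {0..M} t * c)"
  proof (rule set_integral_mono[OF f set_integral_add(1)[OF set_integrable_gap const]])
    show "f t \<le> max (gap \<epsilon> l u t) 0 + indicator {0..M} t * c" if "t \<in> {0..}" for t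
      using that near[of t] far[of t] by (cases "t \<le> M") (auto simp: indicator_def)
  qed
  also have "\<dots> = g \<epsilon> l u + (LBINT t:{0..}. indicator {0..M} t * c)"
    unfolding g_eq by (rule set_integral_add(2)[OF set_integrable_gap const])
  also have "(LBINT t:{0..}. indicator {0..M} t * c) = M * c"
    using M by (simp add: set_lebesgue_integral_def measure_lborel_Icc
          flip: mult.assoc indicator_inter_arith)
  finally show ?thesis .
qed

lemma g_upper_le:
  assumes "0 \<le> M" "u \<le> M"
  shows "g_upper \<epsilon> u \<le> g \<epsilon> l u + M * Phi (l + M)"
  unfolding g_upper_def
proof (rule integral_le_g_plus[OF set_integrable_g_upper \<open>0 \<le> M\<close>])
  show "max (Phi (u - t) - (1 - \<epsilon>)) 0 \<le> max (gap \<epsilon> l u t) 0 + Phi (l + M)"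
    if "t \<le> M" for t
    using that Phi_mono[of "l + t" "l + M"] Phi_nonneg[of "l + M"] by (auto simp: gap_def max_def)
  show "max (Phi (u - t) - (1 - \<epsilon>)) 0 \<le> 0" if "M < t" for t
    using that assms Phi_gt_half_imp_pos[of "u - t"] eps by force
qed

lemma g_lower_le:
  assumes "0 \<le> M" "- M \<le> l"
  shows "g_lower \<epsilon> l \<le> g \<epsilon> l u + M * (1 - Phi (u - M))"
  unfolding g_lower_def
proof (rule integral_le_g_plus[OF set_integrable_g_lower \<open>0 \<le> M\<close>])
  show "max (\<epsilon> - Phi (l + t)) 0 \<le> max (gap \<epsilon> l u t) 0 + (1 - Phi (u - M))"
    if "t \<le> M" for t
    using that Phi_mono[of "u - M" "u - t"] Phi_le_1[of "u - M"] by (auto simp: gap_def max_def)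
  show "max (\<epsilon> - Phi (l + t)) 0 \<le> 0" if "M < t" for t
    using that assms Phi_lt_half_imp_neg[of "l + t"] eps by force
qed

text \<open>Along the level curve only one of \<open>- l\<close> and \<open>u\<close> can be large: when both are, the gap is close
  to \<open>\<epsilon>\<close> on a long interval.\<close>

lemma g_large:
  assumes "0 < \<delta>"
  obtains M where "0 \<le> M" "\<And>l u. l \<le> - M \<Longrightarrow> M \<le> u \<Longrightarrow> \<delta> < g \<epsilon> l u"
proof -
  \<comment> \<open>A gap above \<open>\<epsilon> / 2\<close> on \<open>[0, T]\<close> has area above \<open>\<delta>\<close>.\<close>
  define T where "T = 2 * \<delta> / \<epsilon>"
  have T: "0 < T" "T * (\<epsilon> / 2) = \<delta>"
    using assms eps by (auto simp: T_def)
  have "eventually (\<lambda>x. 1 - \<epsilon> / 4 < Phi x) at_top"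
    using eps by (intro order_tendstoD(1)[OF Phi_at_top]) simp
  then obtain K where K: "1 - \<epsilon> / 4 < Phi K"
    by (auto simp: eventually_at_top_linorder)
  have "\<delta> < g \<epsilon> l u" if "l \<le> - max 0 (K + T)" "max 0 (K + T) \<le> u" for l u
  proof -
    have "Phi K \<le> Phi (u - T)" "Phi (l + T) \<le> 1 - Phi K"
      using that Phi_mono[of K "u - T"] Phi_mono[of "l + T" "- K"] by (auto simp: Phi_uminus)
    then have gap: "\<epsilon> / 2 < gap \<epsilon> l u T"
      using K unfolding gap_def by linarith
    obtain t where "0 < t" "t < T" "gap_area \<epsilon> l u T - gap_area \<epsilon> l u 0 = (T - 0) * gap \<epsilon> l u t"
      using MVT2[OF T(1) DERIV_gap_area] by blast
    then have area: "gap_area \<epsilon> l u T = T * gap \<epsilon> l u t"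
      by simp
    have "T * gap \<epsilon> l u T \<le> T * gap \<epsilon> l u t"
      using \<open>t < T\<close> T(1) by (intro mult_left_mono gap_antimono) auto
    also have "\<dots> \<le> g \<epsilon> l u"
      unfolding area[symmetric] using T(1) by (intro gap_area_le_g) simp
    finally show ?thesis
      using mult_strict_left_mono[OF gap T(1)] T(2) by linarith
  qed
  then show ?thesis
    by (intro that[of "max 0 (K + T)"]) auto
qed

end

section \<open>The bounds and the limit\<close>

lemma refinement_limits:
  shows mesh_refinement: "((\<lambda>(N, l, u). mesh N l u) \<longlongrightarrow> 0) (refinement \<epsilon> \<delta>)"
    and last_l_refinement: "filterlim (\<lambda>(N, l, u). l N) at_bot (refinement \<epsilon> \<delta>)"
    and first_u_refinement: "filterlim (\<lambda>(N, l, u). u 1) at_top (refinement \<epsilon> \<delta>)"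
    and points_refinement: "eventually (\<lambda>(N, l, u). points_on_curve \<epsilon> \<delta> N l u) (refinement \<epsilon> \<delta>)"
proof -
  have "refinement \<epsilon> \<delta> \<le> principal {(N, l, u). points_on_curve \<epsilon> \<delta> N l u}"
    unfolding refinement_def by (intro le_infI2 order_refl)
  then show "eventually (\<lambda>(N, l, u). points_on_curve \<epsilon> \<delta> N l u) (refinement \<epsilon> \<delta>)"
    by (simp add: le_principal case_prod_unfold)
qed (unfold filterlim_iff_le_filtercomap refinement_def,
  rule inf_le1, rule le_infI2[OF inf_le1], rule le_infI2[OF le_infI2[OF inf_le1]])

text \<open>On the curve, \<open>l N \<le> - M\<close> forces \<open>u N \<le> M\<close> and \<open>u 1 \<ge> M\<close> forces \<open>l 1 \<ge> - M\<close>, so the errors in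
  \<open>g_upper_le\<close> and \<open>g_lower_le\<close> are controlled with a constant \<open>M\<close> that is the same for all families.\<close>

lemma boundary_sup_refinement:
  assumes eps: "0 < \<epsilon>" "\<epsilon> < 1 / 2" and delta: "0 < \<delta>"
  shows "((\<lambda>(N, l, u). boundary_sup \<epsilon> N l u) \<longlongrightarrow> ereal \<delta>) (refinement \<epsilon> \<delta>)"
proof -
  obtain M where M: "0 \<le> M" "\<And>l u. l \<le> - M \<Longrightarrow> M \<le> u \<Longrightarrow> \<delta> < g \<epsilon> l u"
    using g_large[OF eps delta] by blast
  define bound where "bound = (\<lambda>(N, l, u). \<delta> + mesh N l u + M * Phi (l N + M) + M * (1 - Phi (u 1 - M)))"
  note lims = mesh_refinement[of \<epsilon> \<delta>] last_l_refinement[of \<epsilon> \<delta>] first_u_refinement[of \<epsilon> \<delta>]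
  have "eventually (\<lambda>(N, l, u). l N \<le> - M) (refinement \<epsilon> \<delta>)"
    using lims(2) by (auto simp: filterlim_at_bot case_prod_unfold)
  moreover have "eventually (\<lambda>(N, l, u). M \<le> u 1) (refinement \<epsilon> \<delta>)"
    using lims(3) by (auto simp: filterlim_at_top case_prod_unfold)
  ultimately have upper: "eventually (\<lambda>z. (case z of (N, l, u) \<Rightarrow> boundary_sup \<epsilon> N l u) \<le> ereal (bound z))
      (refinement \<epsilon> \<delta>)"
    using points_refinement[of \<epsilon> \<delta>]
  proof eventually_elim
    case (elim z)
    obtain N l u where z: "z = (N, l, u)"
      by (cases z)
    have points: "points_on_curve \<epsilon> \<delta> N l u" and ends: "l N \<le> - M" "M \<le> u 1"
      using elim by (auto simp: z)
    note on_curve = g_point[OF eps delta points] and N = N_ge_2[OF eps delta points]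
    have "u N \<le> M"
      using M(2)[of "l N" "u N"] ends on_curve[of N] N by force
    then have "g_upper \<epsilon> (u N) \<le> \<delta> + M * Phi (l N + M)"
      using g_upper_le[OF eps M(1), of "u N" "l N"] on_curve[of N] N by simp
    moreover have "- M \<le> l 1"
      using M(2)[of "l 1" "u 1"] ends on_curve[of 1] N by force
    then have "g_lower \<epsilon> (l 1) \<le> \<delta> + M * (1 - Phi (u 1 - M))"
      using g_lower_le[OF eps M(1), of "l 1" "u 1"] on_curve[of 1] N by simp
    moreover have "0 \<le> mesh N l u" "0 \<le> M * Phi (l N + M)" "0 \<le> M * (1 - Phi (u 1 - M))"
      using mesh_nonneg[OF eps delta points] M(1) Phi_nonneg Phi_le_1 by auto
    ultimately have "Max {\<delta> + mesh N l u, g_upper \<epsilon> (u N), g_lower \<epsilon> (l 1)} \<le> bound z"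
      by (simp add: bound_def z)
    then show ?case
      using order_trans[OF boundary_sup_le[OF eps delta points]] by (simp add: z)
  qed
  have lower: "eventually (\<lambda>z. ereal \<delta> \<le> (case z of (N, l, u) \<Rightarrow> boundary_sup \<epsilon> N l u))
      (refinement \<epsilon> \<delta>)"
    using points_refinement[of \<epsilon> \<delta>]
    by eventually_elim (auto intro: boundary_sup_ge[OF eps delta])
  have "filterlim (\<lambda>(N, l, u). l N + M) at_bot (refinement \<epsilon> \<delta>)"
    using lims(2) unfolding filterlim_at_bot case_prod_unfold le_diff_eq[symmetric] by blast
  from filterlim_compose[OF Phi_at_bot this]
  have "((\<lambda>(N, l, u). Phi (l N + M)) \<longlongrightarrow> 0) (refinement \<epsilon> \<delta>)"
    by (simp add: case_prod_unfold)
  moreover have "filterlim (\<lambda>(N, l, u). u 1 - M) at_top (refinement \<epsilon> \<delta>)"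
    using lims(3) unfolding filterlim_at_top case_prod_unfold le_diff_eq by blast
  from filterlim_compose[OF Phi_at_top this]
  have "((\<lambda>(N, l, u). Phi (u 1 - M)) \<longlongrightarrow> 1) (refinement \<epsilon> \<delta>)"
    by (simp add: case_prod_unfold)
  ultimately have "(bound \<longlongrightarrow> \<delta> + 0 + M * 0 + M * (1 - 1)) (refinement \<epsilon> \<delta>)"
    using lims(1) unfolding bound_def case_prod_unfold by (intro tendsto_intros)
  then have "((\<lambda>z. ereal (bound z)) \<longlongrightarrow> ereal \<delta>) (refinement \<epsilon> \<delta>)"
    by simp
  then show ?thesis
    by (rule tendsto_sandwich[OF lower upper tendsto_const])
qed

theorem theorem2:
  fixes \<epsilon> \<delta> :: real
  assumes "0 < \<epsilon>" and "\<epsilon> < 1 / 2" and "\<delta> > 0"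
  shows "(\<exists>C>0. \<forall>N l u. points_on_curve \<epsilon> \<delta> N l u \<longrightarrow>
            ereal \<delta> \<le> boundary_sup \<epsilon> N l u \<and>
            boundary_sup \<epsilon> N l u
              \<le> ereal (Max {(1 + C * mesh N l u) * \<delta>, g_upper \<epsilon> (u N), g_lower \<epsilon> (l 1)})) \<and>
         ((\<lambda>(N, l, u). boundary_sup \<epsilon> N l u) \<longlongrightarrow> ereal \<delta>) (refinement \<epsilon> \<delta>)"
proof (intro conjI exI[of _ "1 / \<delta>"] allI impI)
  show "0 < 1 / \<delta>"
    using assms by simp
  fix N :: nat and l u :: "nat \<Rightarrow> real"
  assume points: "points_on_curve \<epsilon> \<delta> N l u"
  show "ereal \<delta> \<le> boundary_sup \<epsilon> N l u"
    by (rule boundary_sup_ge[OF assms points])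
  have "(1 + 1 / \<delta> * mesh N l u) * \<delta> = \<delta> + mesh N l u"
    using assms by (simp add: field_simps)
  then show "boundary_sup \<epsilon> N l u
      \<le> ereal (Max {(1 + 1 / \<delta> * mesh N l u) * \<delta>, g_upper \<epsilon> (u N), g_lower \<epsilon> (l 1)})"
    using boundary_sup_le[OF assms points] by simp
qed (rule boundary_sup_refinement[OF assms])

end
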